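(* Let $0<q<1$, let $\eta,c>0$, and let $\kappa,\sigma,u,\nu,\mu\in\mathbb{C}$ with $\Re(\kappa)>0$, $\Re(\sigma)>0$, $c>\Re(\sigma)$, $\Re(\mu)>0$ and $|u|<(1-q)^{-\eta}$. Then $$D_q^{\nu,\mu}\left\{E_{\eta,\kappa}^{(\sigma;c)}(u;q)\right\}=\sum_{m=0}^\infty\frac{B_q(\sigma+m,c-\sigma)}{B_q(\sigma,c-\sigma)}\,\frac{(q^{c};q)_m}{(q;q)_m}\,\frac{\Gamma_q(\nu+\mu+m+1)}{\Gamma_q(\nu+m+1)}\,\frac{u^m}{\Gamma_q(\eta m+\kappa)} .$$ In particular, $$D_q^{\nu,\mu}\,E_{\eta,\kappa}^{(\nu+1;1)}(u;q)=\frac{\Gamma_q(\nu+\mu+1)}{\Gamma_q(\nu+1)}\,E_{\eta,\kappa}^{\nu+\mu}(u;q).$$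
   Context: Let $0<q<1$. For $\lambda\in\mathbb{C}$, $(\lambda;q)_0=1$, $(\lambda;q)_m=\prod_{i=0}^{m-1}(1-\lambda q^i)$ for $m\ge1$, $(\lambda;q)_\infty=\prod_{i\ge0}(1-\lambda q^i)$, and $(\lambda;q)_\tau=\frac{(\lambda;q)_\infty}{(\lambda q^\tau;q)_\infty}$ for $\tau\in\mathbb{C}$. Complex powers are principal values, and $[z]_q=\frac{1-q^z}{1-q}$. The $q$-gamma function is $\Gamma_q(z)=\frac{(q;q)_\infty}{(q^z;q)_\infty}(1-q)^{1-z}$, and the $q$-beta function is $B_q(a,b)=\frac{\Gamma_q(a)\Gamma_q(b)}{\Gamma_q(a+b)}$ for $\Re(a),\Re(b)>0$. The $q$-integral is $\int_0^u f(t)\,d_qt=u(1-q)\sum_{k\ge0}q^kf(uq^k)$, and the $q$-difference operator is $D_qf(u)=\frac{f(u)-f(uq)}{u(1-q)}$ for $u\neq0$, with $(D_qf)(0)=\lim_{u\to0}(D_qf)(u)$. The Kober fractional $q$-integral operator is, for $\Re(\mu)>0$, $$(I_q^{\nu,\mu}f)(u)=\frac{u^{-\nu-\mu}}{\Gamma_q(\mu)}\int_0^u(u-tq)_{\mu-1}\,t^\nu f(t)\,d_qt,\qquad (u-tq)_{\mu-1}=u^{\mu-1}(qt/u;q)_{\mu-1}.$$ The Kober fractional $q$-derivative operator is $$(D_q^{\nu,\mu}f)(u)=\prod_{j=1}^{n}\left([\nu+j]_q+u\,q^{\nu+j}D_q\right)(I_q^{\nu+\mu,\,n-\mu}f)(u),\qquad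 n=[\Re(\mu)]+1,$$ where $[\Re(\mu)]$ is the integer part of $\Re(\mu)$. The generalized $q$-Mittag-Leffler function is $E_{\eta,\kappa}^{\sigma}(u;q)=\sum_{m\ge0}\frac{(q^\sigma;q)_m}{(q;q)_m}\frac{u^m}{\Gamma_q(\eta m+\kappa)}$. For $\Re(c)>\Re(\sigma)>0$ the extended $q$-Mittag-Leffler function is $$E_{\eta,\kappa}^{(\sigma;c)}(u;q)=\sum_{m=0}^\infty\frac{B_q(\sigma+m,c-\sigma)}{B_q(\sigma,c-\sigma)}\,\frac{(q^{c};q)_m}{(q;q)_m}\,\frac{u^m}{\Gamma_q(\eta m+\kappa)}.$$
   Formalization: The condition Re(ν+μ) > -1 is added, since otherwise the q-integral defining the left side diverges; in the special case the right side is E^{ν+μ+1} instead of the printed E^{ν+μ}, which contradicts the main formula already at the coefficient of u. *)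

theory Defs
  imports "HOL-Analysis.Analysis"
begin

definition qpoch :: "real \<Rightarrow> complex \<Rightarrow> nat \<Rightarrow> complex" where
  "qpoch q a m = (\<Prod>i<m. 1 - a * of_real q ^ i)"

definition qpoch_inf :: "real \<Rightarrow> complex \<Rightarrow> complex" where
  "qpoch_inf q a = (\<Prod>i. 1 - a * of_real q ^ i)"

definition qpoch_cpx :: "real \<Rightarrow> complex \<Rightarrow> complex \<Rightarrow> complex" where
  "qpoch_cpx q a \<tau> = qpoch_inf q a / qpoch_inf q (a * of_real q powr \<tau>)"

definition qnum :: "real \<Rightarrow> complex \<Rightarrow> complex" where
  "qnum q z = (1 - of_real q powr z) / of_real (1 - q)"

text \<open>At a pole of the q-gamma function, division by zero gives \<open>qGamma q z = 0\<close>. Hence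
  \<open>w / qGamma q z = 0\<close> there, which agrees with the usual convention that the (entire)
  reciprocal of the q-gamma function vanishes at the poles.\<close>

definition qGamma :: "real \<Rightarrow> complex \<Rightarrow> complex" where
  "qGamma q z = qpoch_inf q (of_real q) / qpoch_inf q (of_real q powr z)
                  * of_real (1 - q) powr (1 - z)"

definition qBeta :: "real \<Rightarrow> complex \<Rightarrow> complex \<Rightarrow> complex" where
  "qBeta q a b = qGamma q a * qGamma q b / qGamma q (a + b)"

definition qintegral :: "real \<Rightarrow> (complex \<Rightarrow> complex) \<Rightarrow> complex \<Rightarrow> complex" where
  "qintegral q f u = u * of_real (1 - q) * (\<Sum>k. of_real q ^ k * f (u * of_real q ^ k))"

definition qdiff :: "real \<Rightarrow> (complex \<Rightarrow> complex) \<Rightarrow> complex \<Rightarrow> complex" where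
  "qdiff q f u =
     (let D = (\<lambda>v. (f v - f (v * of_real q)) / (v * of_real (1 - q)))
      in if u = 0 then Lim (at 0) D else D u)"

definition qkernel :: "real \<Rightarrow> complex \<Rightarrow> complex \<Rightarrow> complex \<Rightarrow> complex" where
  "qkernel q \<mu> u t = u powr (\<mu> - 1) * qpoch_cpx q (of_real q * t / u) (\<mu> - 1)"

text \<open>The expression defining the Kober operators involves \<open>u powr (- \<nu> - \<mu>)\<close> and
  \<open>t / u\<close> and is meaningless at \<open>u = 0\<close>. As for the q-difference operator, the value at
  the origin is taken to be the limit for \<open>u \<rightarrow> 0\<close>.\<close>

definition kober_qint ::
    "real \<Rightarrow> complex \<Rightarrow> complex \<Rightarrow> (complex \<Rightarrow> complex) \<Rightarrow> complex \<Rightarrow> complex" where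
  "kober_qint q \<nu> \<mu> f u =
     (let I = (\<lambda>v. v powr (- \<nu> - \<mu>) / qGamma q \<mu>
                     * qintegral q (\<lambda>t. qkernel q \<mu> v t * t powr \<nu> * f t) v)
      in if u = 0 then Lim (at 0) I else I u)"

definition kober_factor ::
    "real \<Rightarrow> complex \<Rightarrow> nat \<Rightarrow> (complex \<Rightarrow> complex) \<Rightarrow> complex \<Rightarrow> complex" where
  "kober_factor q \<nu> j g u =
     qnum q (\<nu> + of_nat j) * g u + u * of_real q powr (\<nu> + of_nat j) * qdiff q g u"

text \<open>The product over \<open>j = 1, \<dots>, n\<close> is a composition of operators, with the factor for
  \<open>j = n\<close> applied first.\<close>

definition kober_qderiv ::
    "real \<Rightarrow> complex \<Rightarrow> complex \<Rightarrow> (complex \<Rightarrow> complex) \<Rightarrow> complex \<Rightarrow> complex" where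
  "kober_qderiv q \<nu> \<mu> f =
     (let n = nat \<lfloor>Re \<mu>\<rfloor> + 1
      in foldr (kober_factor q \<nu>) [1..<n + 1] (kober_qint q (\<nu> + \<mu>) (of_nat n - \<mu>) f))"

definition qML :: "real \<Rightarrow> complex \<Rightarrow> complex \<Rightarrow> complex \<Rightarrow> complex \<Rightarrow> complex" where
  "qML q \<eta> \<kappa> \<sigma> u =
     (\<Sum>m. qpoch q (of_real q powr \<sigma>) m / qpoch q (of_real q) m
             * (u ^ m / qGamma q (\<eta> * of_nat m + \<kappa>)))"

definition qML_ext ::
    "real \<Rightarrow> complex \<Rightarrow> complex \<Rightarrow> complex \<Rightarrow> complex \<Rightarrow> complex \<Rightarrow> complex" where
  "qML_ext q \<eta> \<kappa> \<sigma> c u =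
     (\<Sum>m. qBeta q (\<sigma> + of_nat m) (c - \<sigma>) / qBeta q \<sigma> (c - \<sigma>)
             * (qpoch q (of_real q powr c) m / qpoch q (of_real q) m)
             * (u ^ m / qGamma q (\<eta> * of_nat m + \<kappa>)))"

end

theory Submission
  imports Defs
begin

text \<open>
  All operators involved act diagonally on powers of \<open>u\<close>, so the theorem is a statement about
  coefficients of power series on the disc of radius \<open>(1 - q) powr (- \<eta>)\<close>.

  The Kober fractional q-integral of order \<open>\<mu>'\<close> and weight \<open>\<nu>'\<close> multiplies \<open>u ^ m\<close> by
  \<open>\<Gamma>(\<nu>' + m + 1) / \<Gamma>(\<nu>' + \<mu>' + m + 1)\<close>. The defining q-integral is a series over the points
  \<open>u * q ^ k\<close>; up to a constant and the \<open>k\<close>-th power of a fixed number, its weights are the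
  coefficients of the q-binomial series, which \<open>q_binomial\<close> sums. An absolutely
  convergent double series carries this over from monomials to power series (\<open>kober_qint_powser\<close>). The hypothesis \<open>Re (\<nu> + \<mu>) > -1\<close> is the convergence condition at
  \<open>\<nu>' = \<nu> + \<mu>\<close>.

  The first-order factor with index \<open>j\<close> multiplies \<open>u ^ m\<close> by the q-number \<open>[\<nu> + j + m]\<close>. Since
  \<open>[z] / \<Gamma>(z + 1) = 1 / \<Gamma>(z)\<close>, the factors \<open>j = n, \<dots>, 1\<close> turn the denominator
  \<open>\<Gamma>(\<nu> + n + m + 1)\<close> produced by the q-integral with \<open>\<nu>' = \<nu> + \<mu>\<close> and \<open>\<mu>' = n - \<mu>\<close> into
  \<open>\<Gamma>(\<nu> + m + 1)\<close> (\<open>kober_factors_powser\<close>), which gives the asserted multiplier.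

  The q-beta quotient equals \<open>(q ^ \<sigma>; q)\<close> over \<open>(q ^ c; q)\<close>, both of length \<open>m\<close>
  (\<open>qBeta_ratio\<close>). Hence the extended q-Mittag-Leffler function has the coefficients of the ordinary
  one with parameter \<open>\<sigma>\<close>. This yields convergence, and for \<open>\<sigma> = \<nu> + 1\<close> the symbol
  \<open>(q ^ (\<nu> + 1); q)\<close> cancels against \<open>\<Gamma>(\<nu> + m + 1)\<close>, which proves the last identity.
\<close>

section \<open>The q-Pochhammer symbol\<close>

lemma qpoch_0 [simp]: "qpoch q a 0 = 1"
  by (simp add: qpoch_def)

lemma qpoch_Suc: "qpoch q a (Suc n) = qpoch q a n * (1 - a * of_real q ^ n)"
  by (simp add: qpoch_def)

lemma convergent_prod_qpoch:
  fixes q :: real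
  assumes "0 < q" "q < 1"
  shows "convergent_prod (\<lambda>i. 1 - a * complex_of_real q ^ i)"
proof (rule abs_convergent_prod_imp_convergent_prod)
  show "abs_convergent_prod (\<lambda>i. 1 - a * complex_of_real q ^ i)"
    using assms by (simp add: abs_convergent_prod_conv_summable norm_mult norm_power summable_mult)
qed

lemma qpoch_tendsto_qpoch_inf:
  fixes q :: real
  assumes "0 < q" "q < 1"
  shows "qpoch q a \<longlonglongrightarrow> qpoch_inf q a"
  unfolding LIMSEQ_lessThan_iff_atMost qpoch_def qpoch_inf_def
  by (rule convergent_prod_LIMSEQ[OF convergent_prod_qpoch[OF assms]])

lemma qpoch_inf_nonzero:
  fixes q :: real
  assumes "0 < q" "q < 1" "norm a < 1"
  shows "qpoch_inf q a \<noteq> 0"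
  unfolding qpoch_inf_def
proof (rule prodinf_nonzero[OF convergent_prod_qpoch[OF assms(1,2)]])
  fix i
  have "norm (a * complex_of_real q ^ i) \<le> norm a * 1"
    unfolding norm_mult norm_power using assms
    by (intro mult_left_mono power_le_one) auto
  with assms(3) have "norm (a * complex_of_real q ^ i) < 1"
    by simp
  then show "1 - a * complex_of_real q ^ i \<noteq> 0"
    by auto
qed

lemma qpoch_nonzero:
  assumes "0 < q" "q < 1" "norm a < 1"
  shows "qpoch q a n \<noteq> 0"
proof
  assume "qpoch q a n = 0"
  then obtain i where i: "a * complex_of_real q ^ i = 1"
    by (auto simp: qpoch_def)
  have "norm (a * complex_of_real q ^ i) \<le> norm a * 1"
    unfolding norm_mult norm_power using assms
    by (intro mult_left_mono power_le_one) auto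
  with i assms(3) show False
    by simp
qed

lemma qpoch_inf_shift:
  fixes q :: real
  assumes "0 < q" "q < 1"
  shows "qpoch_inf q a = qpoch q a n * qpoch_inf q (a * of_real q ^ n)"
proof -
  have "qpoch q a (n + k) = qpoch q a n * qpoch q (a * of_real q ^ n) k" for k
    by (induction k) (simp_all add: qpoch_Suc power_add mult_ac)
  moreover have "(\<lambda>k. qpoch q a (n + k)) \<longlonglongrightarrow> qpoch_inf q a"
    using LIMSEQ_ignore_initial_segment[OF qpoch_tendsto_qpoch_inf[OF assms], of a n]
    by (simp add: add.commute)
  moreover have "(\<lambda>k. qpoch q a n * qpoch q (a * of_real q ^ n) k)
      \<longlonglongrightarrow> qpoch q a n * qpoch_inf q (a * of_real q ^ n)"
    by (intro tendsto_intros qpoch_tendsto_qpoch_inf[OF assms])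
  ultimately show ?thesis
    using LIMSEQ_unique by simp
qed

text \<open>Each factor has norm at most \<open>1 + norm a * q ^ i \<le> exp (norm a * q ^ i)\<close>, and the exponents form a
  geometric series. On the unit disc the bound is uniform in \<open>a\<close>, which controls the reciprocals
  of the q-gamma function along the arguments \<open>\<eta> m + \<kappa>\<close>.\<close>

lemma norm_qpoch_inf_le:
  fixes q :: real
  assumes "0 < q" "q < 1"
  shows "norm (qpoch_inf q a) \<le> exp (norm a / (1 - q))"
proof (rule LIMSEQ_le_const2)
  show "(\<lambda>n. norm (qpoch q a n)) \<longlonglongrightarrow> norm (qpoch_inf q a)"
    by (intro tendsto_norm qpoch_tendsto_qpoch_inf[OF assms])
  have "norm (qpoch q a n) \<le> exp (norm a / (1 - q))" for n
  proof -
    have "norm (qpoch q a n) \<le> (\<Prod>i<n. exp (norm a * q ^ i))"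
      unfolding qpoch_def prod_norm[symmetric]
    proof (rule prod_mono, intro conjI)
      fix i
      have "norm (1 - a * complex_of_real q ^ i) \<le> 1 + norm a * q ^ i"
        using norm_triangle_ineq4[of 1 "a * complex_of_real q ^ i"] assms
        by (simp add: norm_mult norm_power)
      also have "\<dots> \<le> exp (norm a * q ^ i)"
        by (rule exp_ge_add_one_self)
      finally show "norm (1 - a * complex_of_real q ^ i) \<le> exp (norm a * q ^ i)" .
    qed simp
    also have "\<dots> = exp (norm a * (\<Sum>i<n. q ^ i))"
      by (simp add: exp_sum sum_distrib_left)
    also have "(\<Sum>i<n. q ^ i) \<le> 1 / (1 - q)"
      using sum_le_suminf[of "\<lambda>i. q ^ i" "{..<n}"] assms by (simp add: suminf_geometric)
    then have "exp (norm a * (\<Sum>i<n. q ^ i)) \<le> exp (norm a / (1 - q))"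
      using mult_left_mono[of "\<Sum>i<n. q ^ i" "1 / (1 - q)" "norm a"] by simp
    finally show ?thesis .
  qed
  then show "\<exists>N. \<forall>n\<ge>N. norm (qpoch q a n) \<le> exp (norm a / (1 - q))"
    by blast
qed

text \<open>Numerator and denominator converge, and the limit of the denominator does not vanish.\<close>

lemma Bseq_qpoch_ratio:
  assumes "0 < q" "q < 1" "norm b < 1"
  shows "Bseq (\<lambda>n. qpoch q a n / qpoch q b n)"
proof -
  have "(\<lambda>n. qpoch q a n / qpoch q b n) \<longlonglongrightarrow> qpoch_inf q a / qpoch_inf q b"
    using assms by (intro tendsto_divide qpoch_tendsto_qpoch_inf qpoch_inf_nonzero)
  then show ?thesis
    by (intro convergent_imp_Bseq convergentI)
qed

section \<open>The q-binomial theorem\<close>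

lemma summable_Bseq_mult_power:
  fixes b :: "nat \<Rightarrow> complex"
  assumes "Bseq b" "norm z < 1"
  shows "summable (\<lambda>k. norm (b k * z ^ k))"
proof -
  obtain K where K: "\<And>n. norm (b n) \<le> K"
    using assms(1) by (auto simp: Bseq_def)
  show ?thesis
  proof (rule summable_comparison_test'[where N = 0])
    show "summable (\<lambda>k. K * norm z ^ k)"
      using assms(2) by (intro summable_mult summable_geometric) simp
  qed (simp add: norm_mult norm_power mult_right_mono[OF K])
qed

text \<open>Write \<open>F z\<close> for the series. The recurrence
  \<open>c (Suc k) * (1 - q ^ Suc k) = c k * (1 - a * q ^ k)\<close> of its coefficients is equivalent to the
  functional equation \<open>(1 - z) * F z = (1 - a * z) * F (z * q)\<close>. Iterating it \<open>n\<close> times and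
  letting \<open>n\<close> tend to infinity expresses \<open>F z\<close> by two infinite products and \<open>F 0 = 1\<close>,
  because \<open>F\<close> is continuous at the origin.\<close>

theorem q_binomial:
  fixes q :: real
  assumes q: "0 < q" "q < 1" and z: "norm z < 1"
  shows "(\<lambda>k. qpoch q a k / qpoch q (of_real q) k * z ^ k)
           sums (qpoch_inf q (a * z) / qpoch_inf q z)"
proof -
  define c where "c = (\<lambda>k. qpoch q a k / qpoch q (of_real q) k)"
  define F where "F = (\<lambda>z. \<Sum>k. c k * z ^ k)"
  have "Bseq c"
    unfolding c_def using q by (intro Bseq_qpoch_ratio) auto
  then have sm: "summable (\<lambda>k. c k * z ^ k)" if "norm z < 1" for z
    by (rule summable_norm_cancel[OF summable_Bseq_mult_power[OF _ that]])
  have qpow: "norm (complex_of_real q ^ n) \<le> 1" for n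
    using q by (simp add: norm_power power_le_one)
  have c_Suc: "c (Suc k) * (1 - of_real q ^ Suc k) = c k * (1 - a * of_real q ^ k)" for k
  proof -
    have "complex_of_real q ^ Suc k \<noteq> 1"
      using q power_Suc_less_one[of q k] by (metis less_irrefl of_real_eq_1_iff of_real_power)
    moreover have "c (Suc k) = c k * ((1 - a * of_real q ^ k) / (1 - of_real q ^ Suc k))"
      by (simp add: c_def qpoch_Suc)
    ultimately show ?thesis
      by simp
  qed
  have F_step: "(1 - z) * F z = (1 - a * z) * F (z * of_real q)" if z: "norm z < 1" for z
  proof -
    have "norm (z * of_real q) < 1"
      using mult_left_mono[OF qpow[of 1], of "norm z"] z by (simp add: norm_mult)
    from sm[OF this] have sq: "(\<lambda>k. c k * (z * of_real q) ^ k) sums F (z * of_real q)"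
      unfolding F_def by (rule summable_sums)
    from sm[OF z] have s1: "(\<lambda>k. c k * z ^ k) sums F z"
      unfolding F_def by (rule summable_sums)
    have "(\<lambda>k. c k * (1 - of_real q ^ k) * z ^ k) sums (F z - F (z * of_real q))"
      using sums_diff[OF s1 sq] by (simp add: algebra_simps power_mult_distrib)
    then have "(\<lambda>k. c (Suc k) * (1 - of_real q ^ Suc k) * z ^ Suc k)
        sums (F z - F (z * of_real q))"
      by (subst sums_Suc_iff) simp
    moreover have "(\<lambda>k. z * (c k * z ^ k) - a * z * (c k * (z * of_real q) ^ k))
        sums (z * F z - a * z * F (z * of_real q))"
      by (intro sums_diff sums_mult s1 sq)
    moreover have "c (Suc k) * (1 - of_real q ^ Suc k) * z ^ Suc k
        = z * (c k * z ^ k) - a * z * (c k * (z * of_real q) ^ k)" for k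
      unfolding c_Suc by (simp add: algebra_simps power_mult_distrib)
    ultimately have "F z - F (z * of_real q) = z * F z - a * z * F (z * of_real q)"
      using sums_unique2 by simp
    then show ?thesis
      by (simp add: algebra_simps)
  qed
  have iter: "qpoch q z n * F z = qpoch q (a * z) n * F (z * of_real q ^ n)" for n
  proof (induction n)
    case (Suc n)
    have "norm (z * of_real q ^ n) < 1"
      using mult_left_mono[OF qpow[of n], of "norm z"] z by (simp add: norm_mult)
    note step = F_step[OF this]
    have "qpoch q z (Suc n) * F z = (1 - z * of_real q ^ n) * (qpoch q z n * F z)"
      by (simp add: qpoch_Suc)
    also have "\<dots> = qpoch q (a * z) n * ((1 - z * of_real q ^ n) * F (z * of_real q ^ n))"
      unfolding Suc.IH by simp
    also have "\<dots> = qpoch q (a * z) (Suc n) * F (z * of_real q ^ Suc n)"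
      unfolding step by (simp add: qpoch_Suc mult_ac)
    finally show ?case .
  qed simp
  have "isCont F 0"
    unfolding F_def by (rule isCont_powser[where K = "1/2"]) (auto intro: sm)
  moreover have "(\<lambda>n. z * complex_of_real q ^ n) \<longlonglongrightarrow> z * 0"
    using q by (intro tendsto_mult tendsto_const LIMSEQ_power_zero) simp
  ultimately have "(\<lambda>n. F (z * of_real q ^ n)) \<longlonglongrightarrow> F 0"
    by (intro isCont_tendsto_compose[where g = F and l = 0]) auto
  then have "(\<lambda>n. qpoch q (a * z) n * F (z * of_real q ^ n)) \<longlonglongrightarrow> qpoch_inf q (a * z) * F 0"
    by (intro tendsto_mult qpoch_tendsto_qpoch_inf q)
  moreover have "(\<lambda>n. qpoch q z n * F z) \<longlonglongrightarrow> qpoch_inf q z * F z"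
    by (intro tendsto_mult tendsto_const qpoch_tendsto_qpoch_inf q)
  moreover have "F 0 = 1"
    using powser_sums_zero[of c] by (simp add: F_def sums_iff) (simp add: c_def)
  ultimately have "qpoch_inf q z * F z = qpoch_inf q (a * z)"
    using LIMSEQ_unique by (auto simp: iter)
  then have "F z = qpoch_inf q (a * z) / qpoch_inf q z"
    using qpoch_inf_nonzero[OF q z] by (simp add: field_simps)
  then show ?thesis
    using summable_sums[OF sm[OF z]] by (simp add: F_def c_def)
qed

section \<open>Exchanging two summations\<close>

text \<open>The double series is dominated by the product of the absolutely convergent series of \<open>A\<close> and
  of \<open>B\<close>, so Fubini for unordered sums applies. The kernel occurring below is
  \<open>c k m = q ^ (k * m)\<close>: a q-integral samples a power series at the points \<open>v * q ^ k\<close>.\<close>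

lemma suminf_exchange_bounded_kernel:
  fixes A B :: "nat \<Rightarrow> complex" and c :: "nat \<Rightarrow> nat \<Rightarrow> complex"
  assumes A: "summable (\<lambda>m. norm (A m))" and B: "summable (\<lambda>k. norm (B k))"
    and c: "\<And>k m. norm (c k m) \<le> 1"
  shows "(\<lambda>m. A m * (\<Sum>k. B k * c k m)) sums (\<Sum>k. B k * (\<Sum>m. A m * c k m))"
    and "summable (\<lambda>k. B k * (\<Sum>m. A m * c k m))"
proof -
  have sA: "summable (\<lambda>m. norm (A m * c k m))" for k
    using A by (rule summable_comparison_test'[where N = 0])
      (simp add: norm_mult mult_left_le c)
  have sB: "summable (\<lambda>k. norm (B k * c k m))" for m
    using B by (rule summable_comparison_test'[where N = 0])
      (simp add: norm_mult mult_left_le c)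
  have hA: "(\<Sum>\<^sub>\<infinity>m. A m * c k m) = (\<Sum>m. A m * c k m)" for k
    by (intro infsumI norm_summable_imp_has_sum[OF sA] summable_sums summable_norm_cancel[OF sA])
  have hB: "(\<Sum>\<^sub>\<infinity>k. B k * c k m) = (\<Sum>k. B k * c k m)" for m
    by (intro infsumI norm_summable_imp_has_sum[OF sB] summable_sums summable_norm_cancel[OF sB])
  have absA: "(\<lambda>m. norm (A m)) summable_on UNIV"
    and absB: "(\<lambda>k. norm (B k)) summable_on UNIV"
    using norm_summable_imp_summable_on[of "\<lambda>m. norm (A m)"]
      norm_summable_imp_summable_on[of "\<lambda>m. norm (B m)"] A B by auto
  have "(\<lambda>p. norm ((\<lambda>(m, k). A m * B k) p)) summable_on UNIV \<times> UNIV"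
    using absA absB
    by (subst Infinite_Sum.abs_summable_on_Sigma_iff)
      (auto simp: norm_mult infsum_cmult_right' abs_mult infsum_nonneg
        intro!: summable_on_cmult_right summable_on_cmult_left)
  then have "(\<lambda>p. norm ((\<lambda>(m, k). A m * (B k * c k m)) p)) summable_on UNIV \<times> UNIV"
    by (rule Infinite_Sum.abs_summable_on_comparison_test)
       (auto simp: norm_mult mult_left_le c intro!: mult_left_mono)
  then have S: "(\<lambda>(m, k). A m * (B k * c k m)) summable_on UNIV \<times> UNIV"
    by (rule abs_summable_summable)
  have "(\<lambda>m. \<Sum>\<^sub>\<infinity>k. A m * (B k * c k m)) summable_on UNIV"
    using summable_on_Sigma_banach[OF S] .
  then have "((\<lambda>m. \<Sum>\<^sub>\<infinity>k. A m * (B k * c k m)) has_sum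
      (\<Sum>\<^sub>\<infinity>m. \<Sum>\<^sub>\<infinity>k. A m * (B k * c k m))) UNIV"
    by (rule has_sum_infsum)
  also have "(\<Sum>\<^sub>\<infinity>m. \<Sum>\<^sub>\<infinity>k. A m * (B k * c k m)) = (\<Sum>\<^sub>\<infinity>k. \<Sum>\<^sub>\<infinity>m. A m * (B k * c k m))"
    using S by (rule infsum_swap_banach)
  also have "(\<lambda>m. \<Sum>\<^sub>\<infinity>k. A m * (B k * c k m)) = (\<lambda>m. A m * (\<Sum>k. B k * c k m))"
    by (simp add: infsum_cmult_right' hB)
  also have "(\<lambda>k. \<Sum>\<^sub>\<infinity>m. A m * (B k * c k m)) = (\<lambda>k. B k * (\<Sum>m. A m * c k m))"
    by (simp add: mult.left_commute[of "A _"] infsum_cmult_right' hA)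
  finally have hs: "((\<lambda>m. A m * (\<Sum>k. B k * c k m)) has_sum
      (\<Sum>\<^sub>\<infinity>k. B k * (\<Sum>m. A m * c k m))) UNIV" .
  have "summable (\<lambda>k. norm (B k * (\<Sum>m. A m * c k m)))"
  proof (rule summable_comparison_test'[where N = 0])
    show "summable (\<lambda>k. norm (B k) * (\<Sum>m. norm (A m)))"
      using B by (rule summable_mult2)
    fix k
    have "norm (\<Sum>m. A m * c k m) \<le> (\<Sum>m. norm (A m * c k m))"
      by (rule summable_norm[OF sA])
    also have "\<dots> \<le> (\<Sum>m. norm (A m))"
      by (intro suminf_le sA A) (simp add: norm_mult mult_left_le c)
    finally show "norm (norm (B k * (\<Sum>m. A m * c k m))) \<le> norm (B k) * (\<Sum>m. norm (A m))"
      by (simp add: norm_mult mult_left_mono)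
  qed
  note sum_norm = this
  show "summable (\<lambda>k. B k * (\<Sum>m. A m * c k m))"
    using sum_norm by (rule summable_norm_cancel)
  have "(\<Sum>\<^sub>\<infinity>k. B k * (\<Sum>m. A m * c k m)) = (\<Sum>k. B k * (\<Sum>m. A m * c k m))"
    by (intro infsumI norm_summable_imp_has_sum[OF sum_norm] summable_sums
        summable_norm_cancel[OF sum_norm])
  with has_sum_imp_sums[OF hs]
  show "(\<lambda>m. A m * (\<Sum>k. B k * c k m)) sums (\<Sum>k. B k * (\<Sum>m. A m * c k m))"
    by simp
qed

section \<open>Powers with complex exponents\<close>

lemma norm_of_real_powr: "norm (complex_of_real q powr z) = q powr Re z" if "0 < q"
  using that by (simp add: norm_powr_real_powr)

lemma norm_of_real_powr_less_1:
  assumes "0 < q" "q < 1" "Re z > 0"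
  shows "norm (complex_of_real q powr z) < 1"
  using assms powr_less_mono'[of q 0 "Re z"] by (simp add: norm_of_real_powr)

lemma of_real_powr_add_nat:
  "complex_of_real q powr (z + of_nat n) = of_real q powr z * of_real q ^ n" if "0 < q"
  using that by (simp add: powr_add powr_nat')

text \<open>Principal powers are not multiplicative in general; here the second factor is a positive real,
  so the arguments add up without crossing the branch cut.\<close>

lemma powr_mult_of_real_power:
  assumes "0 < q" "v \<noteq> 0"
  shows "(v * complex_of_real q ^ k) powr z = v powr z * (of_real q powr z) ^ k"
proof -
  have "(v * complex_of_real q ^ k) powr z = exp (z * Ln (of_real (q ^ k) * v))"
    using assms by (simp add: powr_def mult.commute)
  also have "Ln (of_real (q ^ k) * v) = Ln (of_real (q ^ k)) + Ln v"
    using assms Ln_times_of_real[of "q ^ k" v] by (simp add: Ln_of_real del: of_real_power)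
  also have "Ln (complex_of_real (q ^ k)) = of_nat k * of_real (ln q)"
    using assms by (simp add: Ln_of_real ln_realpow del: of_real_power)
  also have "z * (of_nat k * of_real (ln q) + Ln v) = of_nat k * (z * of_real (ln q)) + z * Ln v"
    by (simp add: algebra_simps)
  also have "exp \<dots> = exp (z * of_real (ln q)) ^ k * exp (z * Ln v)"
    by (simp only: exp_add exp_of_nat_mult)
  also have "\<dots> = v powr z * (of_real q powr z) ^ k"
    using assms by (simp add: powr_def Ln_of_real)
  finally show ?thesis .
qed

section \<open>The q-gamma and q-beta functions\<close>

lemma qGamma_nonzero:
  assumes "0 < q" "q < 1" "Re z > 0"
  shows "qGamma q z \<noteq> 0"
  using assms qpoch_inf_nonzero[of q "of_real q"] qpoch_inf_nonzero[of q "of_real q powr z"]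
    norm_of_real_powr_less_1[of q z]
  by (simp add: qGamma_def)

lemma qGamma_add_nat:
  assumes "0 < q" "q < 1" "Re z > 0"
  shows "qGamma q (z + of_nat n) = qGamma q z * qpoch q (of_real q powr z) n / of_real (1 - q) ^ n"
proof -
  have nz: "qpoch q (of_real q powr z) n \<noteq> 0"
    using assms by (intro qpoch_nonzero norm_of_real_powr_less_1)
  have "complex_of_real (1 - q) powr (1 - (z + of_nat n))
      = of_real (1 - q) powr (1 - z) / of_real (1 - q) ^ n"
    using assms powr_diff[of "complex_of_real (1 - q)" "1 - z" "of_nat n"]
      powr_nat'[of "complex_of_real (1 - q)" n]
    by (simp add: diff_diff_eq)
  then show ?thesis
    using nz assms qpoch_inf_shift[OF assms(1,2), of "of_real q powr z" n]
    by (simp add: qGamma_def of_real_powr_add_nat)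
qed

text \<open>The functional equation \<open>\<Gamma>(z + 1) = [z] * \<Gamma>(z)\<close> in reciprocal form. In this form it holds
  for every \<open>z\<close>: at a pole of \<open>\<Gamma>(z)\<close> the right-hand side is \<open>1 / 0 = 0\<close>, and on the left either
  \<open>[z]\<close> vanishes or \<open>z + 1\<close> is a pole as well.\<close>

lemma qnum_divide_qGamma:
  assumes "0 < q" "q < 1"
  shows "qnum q z / qGamma q (z + 1) = 1 / qGamma q z"
proof -
  have "complex_of_real (1 - q) powr (1 - z) = of_real (1 - q) * of_real (1 - q) powr (- z)"
    using assms powr_add[of "complex_of_real (1 - q)" 1 "- z"] by simp
  moreover have "qpoch_inf q (of_real q powr z)
      = (1 - of_real q powr z) * qpoch_inf q (of_real q powr (z + 1))"
    using qpoch_inf_shift[OF assms, of "of_real q powr z" 1] assms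
      of_real_powr_add_nat[of q z 1]
    by (simp add: qpoch_def)
  ultimately show ?thesis
    by (simp add: qGamma_def qnum_def)
qed

lemma qGamma_ratio:
  assumes "0 < q" "q < 1"
  shows "qGamma q z / qGamma q (z + \<mu>)
    = of_real (1 - q) powr \<mu>
        * (qpoch_inf q (of_real q powr (z + \<mu>)) / qpoch_inf q (of_real q powr z))"
proof -
  have "complex_of_real (1 - q) powr (1 - z)
      = of_real (1 - q) powr \<mu> * of_real (1 - q) powr (1 - (z + \<mu>))"
    by (simp flip: powr_add)
  moreover have "qpoch_inf q (complex_of_real q) \<noteq> 0"
    using assms by (intro qpoch_inf_nonzero) auto
  moreover have "complex_of_real (1 - q) powr (1 - (z + \<mu>)) \<noteq> 0"
    using assms by simp
  ultimately show ?thesis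
    by (simp add: qGamma_def)
qed

text \<open>The quotients \<open>\<Gamma>(a + m) / \<Gamma>(a)\<close> and \<open>\<Gamma>(a + b + m) / \<Gamma>(a + b)\<close> are finite products, with the
  same power of \<open>1 - q\<close> in the denominator, and \<open>\<Gamma>(b)\<close> cancels. For \<open>b = c - a\<close> the
  denominator cancels the factor \<open>(q ^ c; q)\<close> of the extended q-Mittag-Leffler function.\<close>

lemma qBeta_ratio:
  assumes "0 < q" "q < 1" "Re a > 0" "Re b > 0"
  shows "qBeta q (a + of_nat m) b / qBeta q a b
    = qpoch q (of_real q powr a) m / qpoch q (of_real q powr (a + b)) m"
proof -
  have "Re (a + b) > 0"
    using assms by simp
  then show ?thesis
    using assms qGamma_add_nat[of q a m] qGamma_add_nat[of q "a + b" m]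
      qGamma_nonzero[of q a] qGamma_nonzero[of q b] qGamma_nonzero[of q "a + b"]
    by (simp add: qBeta_def add.assoc add.commute[of "of_nat m"])
qed

section \<open>The Kober fractional q-integral of a power series\<close>

text \<open>The powers of \<open>v\<close> cancel: the prefactor contributes \<open>- \<nu> - \<mu>\<close> to the exponent, the q-integral
  \<open>1\<close>, the kernel \<open>\<mu> - 1\<close> and the weight \<open>\<nu>\<close>. At \<open>t = v * q ^ k\<close> the kernel is
  \<open>v powr (\<mu> - 1)\<close> times the quotient of the infinite products \<open>(q ^ (k + 1); q)\<close> and
  \<open>(q ^ (k + \<mu>); q)\<close>. These are the tails of \<open>(q; q)\<close> and \<open>(q powr \<mu>; q)\<close> after \<open>k\<close> factors, so the
  quotient is a constant times the \<open>k\<close>-th coefficient of the q-binomial series.\<close>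

lemma kober_qint_series:
  assumes q: "0 < q" "q < 1" and \<mu>: "Re \<mu> > 0" and v: "v \<noteq> 0"
    and sm: "summable (\<lambda>k. qpoch q (of_real q powr \<mu>) k / qpoch q (of_real q) k
               * (of_real q powr (\<nu> + 1)) ^ k * f (v * of_real q ^ k))"
  shows "kober_qint q \<nu> \<mu> f v = of_real (1 - q) powr \<mu>
      * (\<Sum>k. qpoch q (of_real q powr \<mu>) k / qpoch q (of_real q) k
               * (of_real q powr (\<nu> + 1)) ^ k * f (v * of_real q ^ k))"
proof -
  let ?x = "\<lambda>k. qpoch q (of_real q powr \<mu>) k / qpoch q (of_real q) k
               * (of_real q powr (\<nu> + 1)) ^ k * f (v * of_real q ^ k)"
  define K where "K = qpoch_inf q (of_real q) / qpoch_inf q (of_real q powr \<mu>)"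
  have nz: "qpoch_inf q (of_real q) \<noteq> 0" "qpoch_inf q (of_real q powr \<mu>) \<noteq> 0"
    using q \<mu> qpoch_inf_nonzero[OF q] norm_of_real_powr_less_1[OF q] by simp_all
  have "of_real q ^ k * (qkernel q \<mu> v (v * of_real q ^ k) * (v * of_real q ^ k) powr \<nu>
          * f (v * of_real q ^ k))
      = v powr (\<mu> - 1) * v powr \<nu> * K * ?x k" for k
  proof -
    have "complex_of_real q * of_real q powr (\<mu> - 1) = of_real q powr \<mu>"
      using q powr_add[of "complex_of_real q" 1 "\<mu> - 1"] by simp
    then have e1: "of_real q * (v * of_real q ^ k) / v * of_real q powr (\<mu> - 1)
        = of_real q powr \<mu> * of_real q ^ k"
      using v by (simp add: mult_ac)
    have e2: "of_real q * (v * of_real q ^ k) / v = of_real q * of_real q ^ k"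
      using v by simp
    have n2: "qpoch q (of_real q) k \<noteq> 0" "qpoch q (of_real q powr \<mu>) k \<noteq> 0"
      using q \<mu> qpoch_nonzero[OF q] norm_of_real_powr_less_1[OF q] by simp_all
    have e3: "qpoch_inf q (of_real q * of_real q ^ k) / qpoch_inf q (of_real q powr \<mu> * of_real q ^ k)
        = K * (qpoch q (of_real q powr \<mu>) k / qpoch q (of_real q) k)"
      using n2 nz qpoch_inf_shift[OF q, of "of_real q" k]
        qpoch_inf_shift[OF q, of "of_real q powr \<mu>" k]
      by (simp add: K_def)
    have e4: "(of_real q powr (\<nu> + 1)) ^ k = (of_real q powr \<nu>) ^ k * complex_of_real q ^ k"
      using q by (simp add: powr_add power_mult_distrib)
    show ?thesis
      unfolding qkernel_def qpoch_cpx_def e1 unfolding e2 e3 e4 powr_mult_of_real_power[OF q(1) v]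
      by (simp only: mult_ac)
  qed
  then have "kober_qint q \<nu> \<mu> f v = v powr (- \<nu> - \<mu>) / qGamma q \<mu>
      * (v * of_real (1 - q) * (v powr (\<mu> - 1) * v powr \<nu> * K * suminf ?x))"
    using v by (simp only: kober_qint_def qintegral_def Let_def if_False suminf_mult[OF sm])
  also have "\<dots> = (v powr (- \<nu> - \<mu>) * (v * (v powr (\<mu> - 1) * v powr \<nu>)))
      * (of_real (1 - q) * K / qGamma q \<mu>) * suminf ?x"
    by simp
  also have "v powr (- \<nu> - \<mu>) * (v * (v powr (\<mu> - 1) * v powr \<nu>)) = 1"
  proof -
    have "v powr (- \<nu> - \<mu>) * (v powr 1 * (v powr (\<mu> - 1) * v powr \<nu>)) = 1"
      using v unfolding powr_add[symmetric] by simp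
    then show ?thesis
      using v by simp
  qed
  also have "of_real (1 - q) * K / qGamma q \<mu> = of_real (1 - q) powr \<mu>"
  proof -
    have "complex_of_real (1 - q) powr \<mu> * of_real (1 - q) powr (1 - \<mu>) = of_real (1 - q)"
      using q by (simp flip: powr_add)
    moreover have "K \<noteq> 0"
      using nz by (simp add: K_def)
    moreover have "qGamma q \<mu> = K * of_real (1 - q) powr (1 - \<mu>)"
      by (simp add: qGamma_def K_def)
    moreover have "complex_of_real (1 - q) powr (1 - \<mu>) \<noteq> 0"
      using q by simp
    ultimately show ?thesis
      by (simp add: divide_eq_eq mult_ac del: of_real_diff)
  qed
  finally show ?thesis
    by simp
qed

text \<open>After the exchange of summations, the coefficient of \<open>v ^ m\<close> is \<open>a m\<close> times a q-binomial series
  at the point \<open>q powr (\<nu> + m + 1)\<close>; its product form is a quotient of q-gamma functions. At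
  the origin the operator is defined as a limit, and the power series just found for \<open>v \<noteq> 0\<close>
  tends to its constant coefficient.\<close>

lemma kober_qint_powser:
  assumes q: "0 < q" "q < 1" and \<mu>: "Re \<mu> > 0" and \<nu>: "Re \<nu> > - 1" and R: "R > 0"
    and f: "\<And>v. norm v < R \<Longrightarrow> (\<lambda>m. a m * v ^ m) sums f v"
    and v: "norm v < R"
  shows "(\<lambda>m. a m * (qGamma q (\<nu> + of_nat m + 1) / qGamma q (\<nu> + \<mu> + of_nat m + 1)) * v ^ m)
           sums kober_qint q \<nu> \<mu> f v"
proof -
  let ?G = "\<lambda>m. qGamma q (\<nu> + of_nat m + 1) / qGamma q (\<nu> + \<mu> + of_nat m + 1)"
  have nonzero: "(\<lambda>m. a m * ?G m * v ^ m) sums kober_qint q \<nu> \<mu> f v"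
    if v: "norm v < R" "v \<noteq> 0" for v
  proof -
    define b where "b = (\<lambda>k. qpoch q (of_real q powr \<mu>) k / qpoch q (of_real q) k)"
    define w where "w = complex_of_real q powr (\<nu> + 1)"
    define c where "c = (\<lambda>k m :: nat. (complex_of_real q ^ k) ^ m)"
    have w: "norm w < 1"
      unfolding w_def using q \<nu> by (intro norm_of_real_powr_less_1) auto
    have c: "norm (c k m) \<le> 1" for k m
      using q by (simp add: c_def norm_power power_le_one)
    \<comment> \<open>The midpoint of \<open>norm v\<close> and \<open>R\<close> gives a larger radius at which the series converges.\<close>
    have A: "summable (\<lambda>m. norm (a m * v ^ m))"
    proof (rule powser_insidea)
      show "norm v < norm (complex_of_real ((norm v + R) / 2))"
        using v by (simp only: norm_of_real) auto
      have "norm (complex_of_real ((norm v + R) / 2)) < R"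
        using v R by (simp only: norm_of_real) (simp add: abs_if, smt (verit) norm_ge_zero)
      from f[OF this] show "summable (\<lambda>m. a m * complex_of_real ((norm v + R) / 2) ^ m)"
        by (rule sums_summable)
    qed
    have "Bseq b"
      unfolding b_def using q by (intro Bseq_qpoch_ratio) auto
    then have B: "summable (\<lambda>k. norm (b k * w ^ k))"
      using w by (rule summable_Bseq_mult_power)
    have fk: "f (v * of_real q ^ k) = (\<Sum>m. a m * v ^ m * c k m)" for k
    proof -
      have "norm (v * of_real q ^ k) < R"
        using v(1) q mult_left_le[of "q ^ k" "norm v"] power_le_one[of q k]
        by (simp add: norm_mult norm_power)
      from sums_unique[OF f[OF this]] show ?thesis
        by (simp add: c_def power_mult_distrib mult_ac)
    qed
    have Bm: "of_real (1 - q) powr \<mu> * (\<Sum>k. b k * w ^ k * c k m) = ?G m" for m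
    proof -
      have wm: "w * of_real q ^ m = of_real q powr (\<nu> + of_nat m + 1)"
        using of_real_powr_add_nat[OF q(1), of "\<nu> + 1" m] by (simp add: w_def add_ac)
      have "norm (w * of_real q ^ m) < 1"
        unfolding wm using q \<nu> by (intro norm_of_real_powr_less_1) auto
      from q_binomial[OF q this, of "of_real q powr \<mu>"]
      have "(\<Sum>k. b k * (w * of_real q ^ m) ^ k)
          = qpoch_inf q (of_real q powr \<mu> * (w * of_real q ^ m)) / qpoch_inf q (w * of_real q ^ m)"
        by (simp add: b_def sums_iff)
      also have "of_real q powr \<mu> * (w * of_real q ^ m) = of_real q powr (\<nu> + of_nat m + 1 + \<mu>)"
        unfolding wm by (simp add: powr_add mult_ac)
      also have "(\<lambda>k. b k * (w * of_real q ^ m) ^ k) = (\<lambda>k. b k * w ^ k * c k m)"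
        by (simp add: c_def power_mult_distrib mult_ac flip: power_mult)
      finally show ?thesis
        using qGamma_ratio[OF q, of "\<nu> + of_nat m + 1" \<mu>] by (simp add: wm add_ac)
    qed
    note exchange = suminf_exchange_bounded_kernel[OF A B c]
    have "kober_qint q \<nu> \<mu> f v
        = of_real (1 - q) powr \<mu> * (\<Sum>k. b k * w ^ k * (\<Sum>m. a m * v ^ m * c k m))"
      using kober_qint_series[OF q \<mu> v(2), of \<nu> f] exchange(2)
      by (simp add: fk b_def w_def)
    with sums_mult[OF exchange(1), of "of_real (1 - q) powr \<mu>"]
    have "(\<lambda>m. a m * v ^ m * (of_real (1 - q) powr \<mu> * (\<Sum>k. b k * w ^ k * c k m)))
        sums kober_qint q \<nu> \<mu> f v"
      by (simp add: mult_ac)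
    then show ?thesis
      unfolding Bm by (simp add: mult_ac)
  qed
  show ?thesis
  proof (cases "v = 0")
    case False
    with nonzero v show ?thesis
      by blast
  next
    case True
    let ?I = "\<lambda>v. v powr (- \<nu> - \<mu>) / qGamma q \<mu>
                     * qintegral q (\<lambda>t. qkernel q \<mu> v t * t powr \<nu> * f t) v"
    have "((\<lambda>v. if v = 0 then a 0 * ?G 0 else ?I v) \<longlongrightarrow> a 0 * ?G 0) (at 0)"
    proof (rule powser_limit_0[OF R])
      fix x :: complex
      assume "norm x < R"
      with nonzero[of x] show "(\<lambda>m. a m * ?G m * x ^ m)
          sums (if x = 0 then a 0 * ?G 0 else ?I x)"
        using powser_sums_zero[of "\<lambda>m. a m * ?G m"] by (auto simp: kober_qint_def Let_def)
    qed
    then have "(?I \<longlongrightarrow> a 0 * ?G 0) (at 0)"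
      by (rule Lim_transform_eventually) (auto simp: eventually_at_filter)
    then have "kober_qint q \<nu> \<mu> f 0 = a 0 * ?G 0"
      by (simp add: kober_qint_def tendsto_Lim)
    then show ?thesis
      using powser_sums_zero[of "\<lambda>m. a m * ?G m"] True by simp
  qed
qed

section \<open>The first-order factors of the Kober fractional q-derivative\<close>

text \<open>On \<open>v ^ m\<close> the q-difference operator acts as multiplication by \<open>[m] / v\<close>, and
  \<open>[\<nu> + j] + q powr (\<nu> + j) * [m] = [\<nu> + j + m]\<close>. At the origin the factor \<open>u\<close> in front of the
  q-difference removes that term.\<close>

lemma kober_factor_powser:
  assumes q: "0 < q" "q < 1"
    and g: "\<And>v. norm v < R \<Longrightarrow> (\<lambda>m. b m * v ^ m) sums g v"
    and v: "norm v < R"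
  shows "(\<lambda>m. qnum q (\<nu> + of_nat j + of_nat m) * b m * v ^ m) sums kober_factor q \<nu> j g v"
proof (cases "v = 0")
  case True
  have "g 0 = b 0"
    using g[of 0] v powser_sums_zero[of b] sums_unique2 True by fastforce
  then show ?thesis
    using powser_sums_zero[of "\<lambda>m. qnum q (\<nu> + of_nat j + of_nat m) * b m"] True
    by (simp add: kober_factor_def)
next
  case False
  define p where "p = complex_of_real q powr (\<nu> + of_nat j)"
  have q1: "1 - complex_of_real q \<noteq> 0"
    using q by simp
  have "norm (v * of_real q) < R"
    using v q mult_left_le[of q "norm v"] by (simp add: norm_mult)
  note s = g[OF v] g[OF this]
  have "(\<lambda>m. qnum q (\<nu> + of_nat j) * (b m * v ^ m)
          + p / of_real (1 - q) * (b m * v ^ m - b m * (v * of_real q) ^ m))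
      sums (qnum q (\<nu> + of_nat j) * g v + p / of_real (1 - q) * (g v - g (v * of_real q)))"
    by (intro sums_add sums_mult sums_diff s)
  also have "qnum q (\<nu> + of_nat j) * g v + p / of_real (1 - q) * (g v - g (v * of_real q))
      = kober_factor q \<nu> j g v"
    using False by (simp add: kober_factor_def qdiff_def p_def)
  also have "(\<lambda>m. qnum q (\<nu> + of_nat j) * (b m * v ^ m)
          + p / of_real (1 - q) * (b m * v ^ m - b m * (v * of_real q) ^ m))
      = (\<lambda>m. qnum q (\<nu> + of_nat j + of_nat m) * b m * v ^ m)"
    unfolding qnum_def of_real_powr_add_nat[OF q(1), of "\<nu> + of_nat j"] p_def[symmetric]
    using q1 by (simp add: power_mult_distrib add_divide_distrib diff_divide_distrib algebra_simps)
  finally show ?thesis .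
qed

text \<open>The factors telescope: by \<open>qnum_divide_qGamma\<close> the operator with index \<open>j\<close> lowers the argument
  of the q-gamma function in the denominator from \<open>\<nu> + j + m + 1\<close> to \<open>\<nu> + j + m\<close>. The division
  by \<open>qGamma\<close> is kept in the coefficient because \<open>\<nu> + m + 1\<close> may be a pole.\<close>

lemma kober_factors_powser:
  assumes q: "0 < q" "q < 1"
    and g: "\<And>v. norm v < R \<Longrightarrow> (\<lambda>m. b m / qGamma q (\<nu> + of_nat n + of_nat m + 1) * v ^ m) sums g v"
    and v: "norm v < R"
  shows "(\<lambda>m. b m / qGamma q (\<nu> + of_nat m + 1) * v ^ m)
           sums foldr (kober_factor q \<nu>) [1..<n + 1] g v"
  using g
proof (induction n arbitrary: g)
  case 0
  then show ?case
    using v by simp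
next
  case (Suc n)
  have "(\<lambda>m. b m / qGamma q (\<nu> + of_nat n + of_nat m + 1) * v ^ m)
      sums kober_factor q \<nu> (Suc n) g v" if "norm v < R" for v
  proof -
    have "qnum q (\<nu> + of_nat (Suc n) + of_nat m)
          * (b m / qGamma q (\<nu> + of_nat (Suc n) + of_nat m + 1))
        = b m / qGamma q (\<nu> + of_nat n + of_nat m + 1)" for m
      using arg_cong[OF qnum_divide_qGamma[OF q, of "\<nu> + of_nat (Suc n) + of_nat m"],
          of "\<lambda>x. b m * x"]
      by (simp add: add_ac mult_ac)
    then show ?thesis
      using kober_factor_powser[OF q Suc.prems that, of \<nu> "Suc n"] by simp
  qed
  from Suc.IH[OF this] show ?case
    by simp
qed

section \<open>The q-Mittag-Leffler functions\<close>

text \<open>Up to bounded factors, \<open>1 / \<Gamma>(\<eta> m + \<kappa>)\<close> is the \<open>m\<close>-th power of \<open>(1 - q) powr \<eta>\<close>; this is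
  where the radius \<open>(1 - q) powr (- \<eta>)\<close> comes from.\<close>

lemma summable_qML:
  assumes q: "0 < q" "q < 1" and \<eta>: "\<eta> > 0" and \<kappa>: "Re \<kappa> > 0"
    and v: "norm v < (1 - q) powr (- \<eta>)"
  shows "summable (\<lambda>m. qpoch q s m / qpoch q (of_real q) m
                         * (v ^ m / qGamma q (of_real \<eta> * of_nat m + \<kappa>)))"
proof -
  let ?r = "complex_of_real (1 - q) powr of_real \<eta>"
  define d where "d = (\<lambda>m. qpoch_inf q (of_real q powr (of_real \<eta> * of_nat m + \<kappa>)))"
  have "norm (d m) \<le> exp (1 / (1 - q))" for m
  proof -
    have "norm (of_real q powr (of_real \<eta> * of_nat m + \<kappa>)) < 1"
      using q \<eta> \<kappa> by (intro norm_of_real_powr_less_1) (auto intro: add_nonneg_pos)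
    then have "norm (of_real q powr (of_real \<eta> * of_nat m + \<kappa>)) / (1 - q) \<le> 1 / (1 - q)"
      using q by (intro divide_right_mono) auto
    then show ?thesis
      using norm_qpoch_inf_le[OF q, of "of_real q powr (of_real \<eta> * of_nat m + \<kappa>)"]
      by (auto simp: d_def intro: order_trans)
  qed
  then have "Bseq d"
    by (rule BseqI')
  moreover have "Bseq (\<lambda>m. qpoch q s m / qpoch q (of_real q) m)"
    using q by (intro Bseq_qpoch_ratio) auto
  moreover define C where "C = of_real (1 - q) powr (\<kappa> - 1) / qpoch_inf q (of_real q)"
  ultimately have bs: "Bseq (\<lambda>m. C * (qpoch q s m / qpoch q (of_real q) m * d m))"
    by (intro Bseq_mult Bfun_const)
  have "norm v * (1 - q) powr \<eta> < (1 - q) powr (- \<eta>) * (1 - q) powr \<eta>"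
    using v q by (intro mult_strict_right_mono) auto
  then have "norm (?r * v) < 1"
    using q by (simp add: norm_mult norm_of_real_powr[of "1 - q"] mult.commute powr_minus del: of_real_diff)
  from summable_norm_cancel[OF summable_Bseq_mult_power[OF bs this]]
  have "summable (\<lambda>m. C * (qpoch q s m / qpoch q (of_real q) m * d m) * (?r * v) ^ m)" .
  moreover have "C * (qpoch q s m / qpoch q (of_real q) m * d m) * (?r * v) ^ m
      = qpoch q s m / qpoch q (of_real q) m
          * (v ^ m / qGamma q (of_real \<eta> * of_nat m + \<kappa>))" for m
  proof -
    have "of_real (1 - q) powr (\<kappa> - 1) * ?r ^ m
        = of_real (1 - q) powr (- (1 - (of_real \<eta> * of_nat m + \<kappa>)))"
      using q by (simp add: powr_def exp_of_nat_mult[symmetric] exp_add[symmetric] algebra_simps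
          del: of_real_diff)
    then have "1 / qGamma q (of_real \<eta> * of_nat m + \<kappa>) = C * d m * ?r ^ m"
      unfolding powr_minus C_def qGamma_def d_def
      by (simp add: divide_inverse mult_ac del: of_real_diff)
    then show ?thesis
      by (simp add: divide_inverse power_mult_distrib mult_ac)
  qed
  ultimately show ?thesis
    by simp
qed

theorem theorem7p2:
  fixes q \<eta> c :: real and \<kappa> \<sigma> u \<nu> \<mu> :: complex
  assumes "0 < q" and "q < 1"
    and "\<eta> > 0" and "c > 0"
    and "Re \<kappa> > 0" and "Re \<sigma> > 0" and "c > Re \<sigma>" and "Re \<mu> > 0"
    and "Re (\<nu> + \<mu>) > -1"
    and "norm u < (1 - q) powr (- \<eta>)"
  shows "(\<lambda>m. qBeta q (\<sigma> + of_nat m) (of_real c - \<sigma>) / qBeta q \<sigma> (of_real c - \<sigma>)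
               * (qpoch q (of_real q powr of_real c) m / qpoch q (of_real q) m)
               * (qGamma q (\<nu> + \<mu> + of_nat m + 1) / qGamma q (\<nu> + of_nat m + 1))
               * (u ^ m / qGamma q (of_real \<eta> * of_nat m + \<kappa>)))
           sums kober_qderiv q \<nu> \<mu> (qML_ext q (of_real \<eta>) \<kappa> \<sigma> (of_real c)) u
       \<and> (\<sigma> = \<nu> + 1 \<and> c = 1 \<longrightarrow>
            kober_qderiv q \<nu> \<mu> (qML_ext q (of_real \<eta>) \<kappa> (\<nu> + 1) 1) u
              = qGamma q (\<nu> + \<mu> + 1) / qGamma q (\<nu> + 1)
                  * qML q (of_real \<eta>) \<kappa> (\<nu> + \<mu> + 1) u)"
proof (intro conjI impI)
  note q = \<open>0 < q\<close> \<open>q < 1\<close>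
  define n where "n = nat \<lfloor>Re \<mu>\<rfloor> + 1"
  define f where "f = qML_ext q (of_real \<eta>) \<kappa> \<sigma> (of_real c)"
  define e where "e = (\<lambda>m. qpoch q (of_real q powr \<sigma>) m / qpoch q (of_real q) m)"
  define G where "G = (\<lambda>m. qGamma q (of_real \<eta> * of_nat m + \<kappa>))"
  let ?R = "(1 - q) powr (- \<eta>)"
  \<comment> \<open>The extended coefficients collapse to those of the ordinary function with parameter \<open>\<sigma>\<close>.\<close>
  have e: "qBeta q (\<sigma> + of_nat m) (of_real c - \<sigma>) / qBeta q \<sigma> (of_real c - \<sigma>)
      * (qpoch q (of_real q powr of_real c) m / qpoch q (of_real q) m) = e m" for m
  proof -
    have "qpoch q (of_real q powr of_real c) m \<noteq> 0"
      using q \<open>c > 0\<close> by (intro qpoch_nonzero norm_of_real_powr_less_1) auto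
    then show ?thesis
      using qBeta_ratio[OF q, of \<sigma> "of_real c - \<sigma>" m] \<open>Re \<sigma> > 0\<close> \<open>c > Re \<sigma>\<close>
      by (simp add: e_def)
  qed
  have f: "(\<lambda>m. e m / G m * v ^ m) sums f v" if "norm v < ?R" for v
    using summable_sums[OF summable_qML[OF q \<open>\<eta> > 0\<close> \<open>Re \<kappa> > 0\<close> that, of "of_real q powr \<sigma>"]]
    unfolding f_def qML_ext_def e by (simp add: e_def G_def)
  \<comment> \<open>The order \<open>n - \<mu>\<close> of the inner fractional integral has positive real part since \<open>n\<close> exceeds \<open>Re \<mu>\<close>.\<close>
  have "Re (of_nat n - \<mu>) > 0"
    using \<open>Re \<mu> > 0\<close> by (simp add: n_def) linarith
  note kober_qint_powser[OF q this \<open>Re (\<nu> + \<mu>) > -1\<close> _ f, of ?R]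
  with q have I: "(\<lambda>m. e m / G m * qGamma q (\<nu> + \<mu> + of_nat m + 1)
        / qGamma q (\<nu> + of_nat n + of_nat m + 1) * v ^ m)
      sums kober_qint q (\<nu> + \<mu>) (of_nat n - \<mu>) f v" if "norm v < ?R" for v
    using that by simp
  have "kober_qderiv q \<nu> \<mu> f
      = foldr (kober_factor q \<nu>) [1..<n + 1] (kober_qint q (\<nu> + \<mu>) (of_nat n - \<mu>) f)"
    by (simp add: kober_qderiv_def n_def Let_def)
  with kober_factors_powser[OF q I \<open>norm u < ?R\<close>]
  have main: "(\<lambda>m. e m / G m * qGamma q (\<nu> + \<mu> + of_nat m + 1) / qGamma q (\<nu> + of_nat m + 1) * u ^ m)
      sums kober_qderiv q \<nu> \<mu> f u"
    by simp
  then show "(\<lambda>m. qBeta q (\<sigma> + of_nat m) (of_real c - \<sigma>) / qBeta q \<sigma> (of_real c - \<sigma>)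
               * (qpoch q (of_real q powr of_real c) m / qpoch q (of_real q) m)
               * (qGamma q (\<nu> + \<mu> + of_nat m + 1) / qGamma q (\<nu> + of_nat m + 1))
               * (u ^ m / qGamma q (of_real \<eta> * of_nat m + \<kappa>)))
           sums kober_qderiv q \<nu> \<mu> (qML_ext q (of_real \<eta>) \<kappa> \<sigma> (of_real c)) u"
    unfolding e f_def by (simp add: G_def mult_ac)
  assume special: "\<sigma> = \<nu> + 1 \<and> c = 1"
  \<comment> \<open>For \<open>\<sigma> = \<nu> + 1\<close> the factor \<open>e m\<close> cancels against \<open>\<Gamma>(\<nu> + m + 1)\<close>.\<close>
  let ?t = "\<lambda>m. qpoch q (of_real q powr (\<nu> + \<mu> + 1)) m / qpoch q (of_real q) m * (u ^ m / G m)"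
  have "e m / G m * qGamma q (\<nu> + \<mu> + of_nat m + 1) / qGamma q (\<nu> + of_nat m + 1) * u ^ m
      = qGamma q (\<nu> + \<mu> + 1) / qGamma q (\<nu> + 1) * ?t m" for m
  proof -
    have *: "qpoch q (of_real q powr (\<nu> + 1)) m \<noteq> 0"
      using q special \<open>Re \<sigma> > 0\<close> by (intro qpoch_nonzero norm_of_real_powr_less_1) auto
    have "qGamma q (\<nu> + \<mu> + of_nat m + 1)
        = qGamma q (\<nu> + \<mu> + 1) * qpoch q (of_real q powr (\<nu> + \<mu> + 1)) m / of_real (1 - q) ^ m"
      using qGamma_add_nat[OF q, of "\<nu> + \<mu> + 1" m] \<open>Re (\<nu> + \<mu>) > -1\<close> by (simp add: add_ac)
    moreover have "qGamma q (\<nu> + of_nat m + 1)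
        = qGamma q (\<nu> + 1) * qpoch q (of_real q powr (\<nu> + 1)) m / of_real (1 - q) ^ m"
      using qGamma_add_nat[OF q, of "\<nu> + 1" m] special \<open>Re \<sigma> > 0\<close> by (simp add: add_ac)
    ultimately show ?thesis
      using * q special by (simp add: e_def mult_ac)
  qed
  with main have "(\<lambda>m. qGamma q (\<nu> + \<mu> + 1) / qGamma q (\<nu> + 1) * ?t m) sums kober_qderiv q \<nu> \<mu> f u"
    by simp
  moreover have "(\<lambda>m. qGamma q (\<nu> + \<mu> + 1) / qGamma q (\<nu> + 1) * ?t m)
      sums (qGamma q (\<nu> + \<mu> + 1) / qGamma q (\<nu> + 1) * qML q (of_real \<eta>) \<kappa> (\<nu> + \<mu> + 1) u)"
    unfolding qML_def G_def
    by (intro sums_mult summable_sums summable_qML q \<open>\<eta> > 0\<close> \<open>Re \<kappa> > 0\<close> \<open>norm u < ?R\<close>)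
  ultimately show "kober_qderiv q \<nu> \<mu> (qML_ext q (of_real \<eta>) \<kappa> (\<nu> + 1) 1) u
              = qGamma q (\<nu> + \<mu> + 1) / qGamma q (\<nu> + 1)
                  * qML q (of_real \<eta>) \<kappa> (\<nu> + \<mu> + 1) u"
    using sums_unique2 special by (simp add: f_def)
qed

end
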